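(* Let $G$ be a Hausdorff paratopological group. Then $G$ is meager if and only if $G$ is shift-meager.
   Context: A paratopological group is a group $G$ endowed with a topology for which the group operation $\cdot:G\times G\to G$ is jointly continuous (inversion is not assumed continuous). $G$ is meager if, as a topological space, it is a countable union of nowhere dense subsets of itself. For subsets $C,A\subset G$ put $CA=\{ca:c\in C,a\in A\}$. $G$ is left meager (resp. right meager) if $G=CA$ (resp. $G=AC$) for some nowhere dense subset $A\subset G$ and some countable subset $C\subset G$. $G$ is shift-meager if it is both left meager and right meager. *)

theory Defs
  imports "HOL-Analysis.Analysis" "HOL-Algebra.Coset"
begin

locale paratopological_group = group G for G (structure) +
  fixes T :: "'a topology"
  assumes topspace_eq_carrier: "topspace T = carrier G"
    and continuous_mult: "continuous_map (prod_topology T T) T (\<lambda>(x, y). x \<otimes> y)"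

definition nowhere_dense_in :: "'a topology \<Rightarrow> 'a set \<Rightarrow> bool" where
  "nowhere_dense_in T A \<longleftrightarrow> A \<subseteq> topspace T \<and> T interior_of (T closure_of A) = {}"

definition meager_space :: "'a topology \<Rightarrow> bool" where
  "meager_space T \<longleftrightarrow>
     (\<exists>\<F>. countable \<F> \<and> (\<forall>A\<in>\<F>. nowhere_dense_in T A) \<and> topspace T = \<Union>\<F>)"

definition left_meager :: "('a, 'b) monoid_scheme \<Rightarrow> 'a topology \<Rightarrow> bool" where
  "left_meager G T \<longleftrightarrow>
     (\<exists>A C. nowhere_dense_in T A \<and> C \<subseteq> carrier G \<and> countable C \<and>
        carrier G = C <#>\<^bsub>G\<^esub> A)"

definition right_meager :: "('a, 'b) monoid_scheme \<Rightarrow> 'a topology \<Rightarrow> bool" where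
  "right_meager G T \<longleftrightarrow>
     (\<exists>A C. nowhere_dense_in T A \<and> C \<subseteq> carrier G \<and> countable C \<and>
        carrier G = A <#>\<^bsub>G\<^esub> C)"

definition shift_meager :: "('a, 'b) monoid_scheme \<Rightarrow> 'a topology \<Rightarrow> bool" where
  "shift_meager G T \<longleftrightarrow> left_meager G T \<and> right_meager G T"

end

theory Submission
  imports Defs
begin

text \<open>
  One direction is immediate: if \<open>G = CA\<close> with \<open>C\<close> countable and \<open>A\<close> nowhere dense, then
  translations being homeomorphisms makes \<open>G\<close> a countable union of the nowhere dense sets \<open>cA\<close>.

  The converse is a statement about group actions. Left translations, and also the maps
  \<open>x \<mapsto> x g\<inverse>\<close>, form a free action of \<open>G\<close> on itself by homeomorphisms, so it suffices to show:
  if an infinite group acts freely by homeomorphisms on a meager Hausdorff space \<open>X\<close>, then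
  countably many translates of a single nowhere dense set cover \<open>X\<close>
  (\<open>meager_imp_countable_translates_cover\<close>). The group is infinite here, since a nonempty meager
  space cannot be finite.

  Let \<open>X\<close> be the union of nowhere dense sets \<open>N\<^sub>0, N\<^sub>1, \<dots>\<close>. The sets \<open>N\<^sub>m\<close> must be moved to places where
  their union stays nowhere dense. There are two ways to do so: along infinitely many disjoint
  translates of one open set, or inside a decreasing sequence of open sets that is locally finite
  off a nowhere dense set. A single construction provides both. Fix distinct elements
  \<open>c\<^sub>0, c\<^sub>1, \<dots>\<close> of the group and let \<open>g\<^sub>0, g\<^sub>1, \<dots>\<close> enumerate the quotients \<open>c\<^sub>i\<inverse> c\<^sub>j\<close> with \<open>i \<noteq> j\<close>.
  Put \<open>V\<^sub>0 = X\<close>, and let \<open>V\<^sub>n\<^sub>+\<^sub>1\<close> be a maximal open subset of \<open>V\<^sub>n\<close> that is disjoint from its translate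
  by \<open>g\<^sub>n\<close>. Maximality, the Hausdorff property and freeness imply that \<open>V\<^sub>n\<^sub>+\<^sub>1\<close> and its
  translates by \<open>g\<^sub>n\<close> and \<open>g\<^sub>n\<inverse>\<close> together are dense in \<open>V\<^sub>n\<close>
  (\<open>maximal_displaced_open_subset\<close>). Hence a point can be carried from \<open>V\<^sub>n\<close> to \<open>V\<^sub>n\<^sub>+\<^sub>1\<close> by one of three
  group elements, unless it lies in a nowhere dense remainder \<open>R\<^sub>n\<close>. So after \<open>n\<close> steps only a finite
  set \<open>K\<^sub>n\<close> of group elements has been used, and a point of \<open>N\<^sub>m\<close> either has met some \<open>R\<^sub>n\<close> or has
  reached the nowhere dense set \<open>V\<^sub>m \<inter> K\<^sub>m N\<^sub>m\<close>. In this way every orbit meets the union of nowhere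
  dense sets \<open>D\<^sub>n \<subseteq> V\<^sub>n\<close>.

  Let \<open>E\<close> be the intersection of the closures of the \<open>V\<^sub>n\<close> and \<open>P\<close> its interior. Off \<open>E\<close> the union of
  the \<open>D\<^sub>n\<close> is nowhere dense, because the \<open>V\<^sub>n\<close> are locally finite there
  (\<open>nowhere_dense_in_decreasing_union\<close>). The boundary \<open>E - P\<close> is nowhere dense. Finally \<open>P\<close> is
  disjoint from all its translates by the \<open>g\<^sub>n\<close> (\<open>closure_displaced\<close>), that is, the sets \<open>c\<^sub>n P\<close> are
  pairwise disjoint, so the points of \<open>P \<inter> N\<^sub>n\<close> can be moved by \<open>c\<^sub>n\<close> into the nowhere dense set
  \<open>\<Union>\<^sub>n c\<^sub>n (P \<inter> N\<^sub>n)\<close> (\<open>nowhere_dense_in_disjoint_union\<close>).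
\<close>

(* The infix closure_of below is topological closure; setoids have an operation of that name too. *)
no_notation eq_closure_of (\<open>closure'_of\<index>\<close>)

section \<open>Nowhere dense sets\<close>

text \<open>The form in which nowhere density is used below: holes can be punched one after the other, or
  separately in different regions of the space.\<close>

lemma nowhere_dense_in_iff_open_hole:
  "nowhere_dense_in T A \<longleftrightarrow> A \<subseteq> topspace T \<and>
     (\<forall>U. openin T U \<and> U \<noteq> {} \<longrightarrow> (\<exists>V. openin T V \<and> V \<noteq> {} \<and> V \<subseteq> U \<and> V \<inter> A = {}))"
  (is "_ \<longleftrightarrow> _ \<and> ?hole")
proof (intro iffI conjI allI impI)
  assume nd: "nowhere_dense_in T A"
  then show "A \<subseteq> topspace T" by (simp add: nowhere_dense_in_def)
  fix U assume U: "openin T U \<and> U \<noteq> {}"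
  have "\<not> U \<subseteq> T closure_of A"
    using U nd interior_of_maximal[of U "T closure_of A" T] by (auto simp: nowhere_dense_in_def)
  moreover have "(U - T closure_of A) \<inter> A = {}"
    using closure_of_subset[OF \<open>A \<subseteq> topspace T\<close>] by auto
  ultimately show "\<exists>V. openin T V \<and> V \<noteq> {} \<and> V \<subseteq> U \<and> V \<inter> A = {}"
    using U by (intro exI[of _ "U - T closure_of A"]) (auto simp: openin_diff)
next
  assume A: "A \<subseteq> topspace T \<and> ?hole"
  have "T interior_of (T closure_of A) = {}"
  proof (rule ccontr)
    assume "T interior_of (T closure_of A) \<noteq> {}"
    then obtain V where V: "openin T V" "V \<noteq> {}" "V \<subseteq> T interior_of (T closure_of A)" "V \<inter> A = {}"
      using A openin_interior_of by metis
    then have "V \<inter> T closure_of A = {}" by (simp add: openin_Int_closure_of_eq_empty)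
    then show False using V interior_of_subset by fastforce
  qed
  then show "nowhere_dense_in T A" using A by (simp add: nowhere_dense_in_def)
qed

lemma nowhere_dense_inI:
  assumes "A \<subseteq> topspace T"
    and "\<And>U. openin T U \<Longrightarrow> U \<noteq> {} \<Longrightarrow> \<exists>V. openin T V \<and> V \<noteq> {} \<and> V \<subseteq> U \<and> V \<inter> A = {}"
  shows "nowhere_dense_in T A"
  unfolding nowhere_dense_in_iff_open_hole[of T A] using assms by simp

lemma nowhere_dense_inE:
  assumes "nowhere_dense_in T A" "openin T U" "U \<noteq> {}"
  obtains V where "openin T V" "V \<noteq> {}" "V \<subseteq> U" "V \<inter> A = {}"
  using assms unfolding nowhere_dense_in_iff_open_hole[of T A] by metis

lemma nowhere_dense_in_subset_topspace: "nowhere_dense_in T A \<Longrightarrow> A \<subseteq> topspace T"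
  by (simp add: nowhere_dense_in_def)

lemma nowhere_dense_in_mono:
  assumes "nowhere_dense_in T B" "A \<subseteq> B"
  shows "nowhere_dense_in T A"
  using assms closure_of_mono[OF assms(2), of T] interior_of_mono
  unfolding nowhere_dense_in_def by (metis subset_empty subset_trans)

lemma nowhere_dense_in_empty: "nowhere_dense_in T {}"
  by (simp add: nowhere_dense_in_def)

lemma nowhere_dense_in_Un:
  assumes A: "nowhere_dense_in T A" and B: "nowhere_dense_in T B"
  shows "nowhere_dense_in T (A \<union> B)"
proof (rule nowhere_dense_inI)
  show "A \<union> B \<subseteq> topspace T" using A B by (simp add: nowhere_dense_in_subset_topspace)
  fix U assume "openin T U" "U \<noteq> {}"
  then obtain V where V: "openin T V" "V \<noteq> {}" "V \<subseteq> U" "V \<inter> A = {}"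
    using nowhere_dense_inE[OF A] by metis
  then obtain W where "openin T W" "W \<noteq> {}" "W \<subseteq> V" "W \<inter> B = {}"
    using nowhere_dense_inE[OF B] by metis
  then show "\<exists>V. openin T V \<and> V \<noteq> {} \<and> V \<subseteq> U \<and> V \<inter> (A \<union> B) = {}"
    using V by (intro exI[of _ W]) auto
qed

lemma nowhere_dense_in_Union_finite:
  assumes "finite \<F>" "\<And>A. A \<in> \<F> \<Longrightarrow> nowhere_dense_in T A"
  shows "nowhere_dense_in T (\<Union>\<F>)"
  using assms
  by (induction \<F> rule: finite_induct) (auto simp: nowhere_dense_in_empty nowhere_dense_in_Un)

lemma nowhere_dense_in_closed_minus_interior:
  assumes "closedin T E"
  shows "nowhere_dense_in T (E - T interior_of E)"
proof (rule nowhere_dense_inI)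
  show "E - T interior_of E \<subseteq> topspace T" using closedin_subset[OF assms] by auto
  fix U assume U: "openin T U" "U \<noteq> {}"
  show "\<exists>V. openin T V \<and> V \<noteq> {} \<and> V \<subseteq> U \<and> V \<inter> (E - T interior_of E) = {}"
  proof (cases "U \<subseteq> E")
    case True
    then show ?thesis using U interior_of_maximal[OF True U(1)] by (intro exI[of _ U]) auto
  next
    case False
    then show ?thesis using U assms by (intro exI[of _ "U - E"]) (auto simp: openin_diff)
  qed
qed

lemma nowhere_dense_in_minus_dense_open:
  assumes "openin T U" "openin T W" "U \<subseteq> T closure_of W"
  shows "nowhere_dense_in T (U - W)"
proof (rule nowhere_dense_inI)
  show "U - W \<subseteq> topspace T" using openin_subset[OF assms(1)] by auto
  fix O' assume O': "openin T O'" "O' \<noteq> {}"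
  show "\<exists>V. openin T V \<and> V \<noteq> {} \<and> V \<subseteq> O' \<and> V \<inter> (U - W) = {}"
  proof (cases "O' \<inter> U = {}")
    case True
    then show ?thesis using O' by (intro exI[of _ O']) auto
  next
    case False
    moreover have "openin T (O' \<inter> U)" using O' assms by (simp add: openin_Int)
    ultimately have "O' \<inter> U \<inter> W \<noteq> {}"
      using assms(3) openin_Int_closure_of_eq_empty[of T "O' \<inter> U" W] by auto
    then show ?thesis using O' assms
      by (intro exI[of _ "O' \<inter> U \<inter> W"]) (auto simp: openin_Int)
  qed
qed

text \<open>An open set that meets some \<open>P i\<close> can be shrunk into it, where only \<open>B i\<close> is left to avoid.
  The index set may be infinite.\<close>

lemma nowhere_dense_in_disjoint_union:
  assumes nd: "\<And>i. i \<in> I \<Longrightarrow> nowhere_dense_in T (B i)"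
    and op: "\<And>i. i \<in> I \<Longrightarrow> openin T (P i)" and sub: "\<And>i. i \<in> I \<Longrightarrow> B i \<subseteq> P i"
    and disj: "disjoint_family_on P I"
  shows "nowhere_dense_in T (\<Union>i\<in>I. B i)"
proof (rule nowhere_dense_inI)
  show "(\<Union>i\<in>I. B i) \<subseteq> topspace T" using nd nowhere_dense_in_subset_topspace by blast
  fix U assume U: "openin T U" "U \<noteq> {}"
  show "\<exists>V. openin T V \<and> V \<noteq> {} \<and> V \<subseteq> U \<and> V \<inter> (\<Union>i\<in>I. B i) = {}"
  proof (cases "\<exists>i\<in>I. U \<inter> P i \<noteq> {}")
    case False
    then show ?thesis using U sub by (intro exI[of _ U]) blast
  next
    case True
    then obtain i where i: "i \<in> I" "U \<inter> P i \<noteq> {}" by blast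
    then obtain V where V: "openin T V" "V \<noteq> {}" "V \<subseteq> U \<inter> P i" "V \<inter> B i = {}"
      using nowhere_dense_inE[OF nd[OF i(1)]] U op by (metis openin_Int)
    have "V \<inter> B j = {}" if "j \<in> I" for j
    proof (cases "j = i")
      case False
      then have "P i \<inter> P j = {}" using disj i(1) that by (simp add: disjoint_family_on_def)
      then show ?thesis using V(3) sub[OF that] by blast
    qed (use V in simp)
    then show ?thesis using V by (intro exI[of _ V]) auto
  qed
qed

text \<open>A point outside the closure of \<open>V n\<close> has a neighbourhood that misses \<open>V m\<close>, and so \<open>D m\<close>, for all
  \<open>m \<ge> n\<close>. Near such a point the union is therefore a finite one.\<close>

lemma nowhere_dense_in_decreasing_union:
  assumes nd: "\<And>n::nat. nowhere_dense_in T (D n)"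
    and sub: "\<And>n. D n \<subseteq> V n" and top: "\<And>n. V n \<subseteq> topspace T" and dec: "decseq V"
  shows "nowhere_dense_in T ((\<Union>n. D n) - (\<Inter>n. T closure_of V n))"
proof (rule nowhere_dense_inI)
  show "(\<Union>n. D n) - (\<Inter>n. T closure_of V n) \<subseteq> topspace T" using sub top by blast
  fix U assume U: "openin T U" "U \<noteq> {}"
  show "\<exists>W. openin T W \<and> W \<noteq> {} \<and> W \<subseteq> U \<and> W \<inter> ((\<Union>n. D n) - (\<Inter>n. T closure_of V n)) = {}"
  proof (cases "U \<subseteq> (\<Inter>n. T closure_of V n)")
    case True
    then show ?thesis using U by (intro exI[of _ U]) auto
  next
    case False
    then obtain n where "U - T closure_of V n \<noteq> {}" by auto
    moreover have "openin T (U - T closure_of V n)" using U by (simp add: openin_diff)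
    moreover have "nowhere_dense_in T (\<Union>(D ` {..<n}))"
      using nd by (intro nowhere_dense_in_Union_finite) auto
    ultimately obtain W where W: "openin T W" "W \<noteq> {}" "W \<subseteq> U - T closure_of V n"
      "W \<inter> \<Union>(D ` {..<n}) = {}"
      using nowhere_dense_inE by metis
    have "W \<inter> D m = {}" for m
    proof (cases "m < n")
      case True
      then show ?thesis using W(4) by blast
    next
      case False
      then have "D m \<subseteq> V n" using sub[of m] decseqD[OF dec, of n m] by auto
      then show ?thesis using W(3) closure_of_subset[OF top[of n]] by blast
    qed
    then show ?thesis using W by (intro exI[of _ W]) auto
  qed
qed

lemma nowhere_dense_in_homeomorphic_image:
  assumes h: "homeomorphic_map T T h" and A: "nowhere_dense_in T A"
  shows "nowhere_dense_in T (h ` A)"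
proof -
  have s: "A \<subseteq> topspace T" using A by (rule nowhere_dense_in_subset_topspace)
  have "T closure_of (h ` A) = h ` (T closure_of A)"
    using homeomorphic_map_closure_of[OF h s] .
  moreover have "T interior_of (h ` (T closure_of A)) = h ` (T interior_of (T closure_of A))"
    by (rule homeomorphic_map_interior_of[OF h closure_of_subset_topspace])
  moreover have "h ` A \<subseteq> topspace T"
    using s homeomorphic_imp_surjective_map[OF h] by blast
  ultimately show ?thesis using A by (simp add: nowhere_dense_in_def)
qed

text \<open>A finite space has only finitely many subsets, so a meager one would be nowhere dense in
  itself.\<close>

lemma meager_space_imp_infinite:
  assumes "meager_space T" "topspace T \<noteq> {}"
  shows "infinite (topspace T)"
proof
  assume fin: "finite (topspace T)"
  obtain \<F> where \<F>: "\<And>A. A \<in> \<F> \<Longrightarrow> nowhere_dense_in T A" "topspace T = \<Union>\<F>"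
    using assms by (auto simp: meager_space_def)
  then have "finite \<F>" using fin by (simp add: finite_UnionD)
  then have "nowhere_dense_in T (topspace T)" using nowhere_dense_in_Union_finite[of \<F>] \<F> by simp
  then show False using nowhere_dense_inE[OF _ openin_topspace assms(2)] openin_subset by blast
qed

section \<open>Free actions by homeomorphisms\<close>

text \<open>Treating translations as an action lets left and right translations share one proof. Each map
  \<open>act g\<close> is a homeomorphism, because its inverse \<open>act (inv g)\<close> is continuous as well.\<close>

locale free_continuous_action = group G for G (structure) +
  fixes T :: "'b topology" and act :: "'a \<Rightarrow> 'b \<Rightarrow> 'b"
  assumes act_continuous: "g \<in> carrier G \<Longrightarrow> continuous_map T T (act g)"
    and act_one: "x \<in> topspace T \<Longrightarrow> act \<one> x = x"
    and act_mult: "g \<in> carrier G \<Longrightarrow> h \<in> carrier G \<Longrightarrow> x \<in> topspace T \<Longrightarrow>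
      act (g \<otimes> h) x = act g (act h x)"
    and act_free: "g \<in> carrier G \<Longrightarrow> x \<in> topspace T \<Longrightarrow> act g x = x \<Longrightarrow> g = \<one>"
begin

lemma act_closed: "g \<in> carrier G \<Longrightarrow> x \<in> topspace T \<Longrightarrow> act g x \<in> topspace T"
  using act_continuous continuous_map_image_subset_topspace by blast

lemma act_inv_act:
  "g \<in> carrier G \<Longrightarrow> x \<in> topspace T \<Longrightarrow> act (inv g) (act g x) = x"
  by (metis act_mult act_one inv_closed l_inv)

lemma act_act_inv:
  "g \<in> carrier G \<Longrightarrow> x \<in> topspace T \<Longrightarrow> act g (act (inv g) x) = x"
  by (metis act_mult act_one inv_closed r_inv)

lemma homeomorphic_map_act: "g \<in> carrier G \<Longrightarrow> homeomorphic_map T T (act g)"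
  by (rule homeomorphic_maps_imp_map[of _ _ _ "act (inv g)"])
     (auto simp: homeomorphic_maps_def act_continuous act_inv_act act_act_inv)

lemma openin_act_image: "g \<in> carrier G \<Longrightarrow> openin T U \<Longrightarrow> openin T (act g ` U)"
  by (metis homeomorphic_map_act homeomorphic_map_openness openin_subset)

lemma nowhere_dense_in_act_image:
  "g \<in> carrier G \<Longrightarrow> nowhere_dense_in T A \<Longrightarrow> nowhere_dense_in T (act g ` A)"
  by (rule nowhere_dense_in_homeomorphic_image[OF homeomorphic_map_act])

lemma act_in_image_iff:
  assumes "g \<in> carrier G" "x \<in> topspace T" "U \<subseteq> topspace T"
  shows "x \<in> act g ` U \<longleftrightarrow> act (inv g) x \<in> U"
proof
  assume "x \<in> act g ` U"
  then show "act (inv g) x \<in> U" using assms act_inv_act[OF assms(1)] by auto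
next
  assume "act (inv g) x \<in> U"
  then have "act g (act (inv g) x) \<in> act g ` U" by blast
  then show "x \<in> act g ` U" by (simp add: act_act_inv[OF assms(1,2)])
qed

lemma act_image_disjoint_iff:
  assumes "g \<in> carrier G" "h \<in> carrier G" "U \<subseteq> topspace T"
  shows "act g ` U \<inter> act h ` U = {} \<longleftrightarrow> U \<inter> act (inv g \<otimes> h) ` U = {}"
proof -
  have "act g u = act h v \<longleftrightarrow> u = act (inv g \<otimes> h) v" if "u \<in> U" "v \<in> U" for u v
  proof -
    have "u \<in> topspace T" "v \<in> topspace T" using that assms by auto
    then show ?thesis
      using assms act_mult[of "inv g" h v] act_inv_act act_act_inv act_closed by (metis inv_closed)
  qed
  then show ?thesis by blast
qed

text \<open>The set \<open>V\<close> comes from Zorn's lemma. If some \<open>x \<in> Q\<close> were outside the closure of the union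
  of the three translates, then, since \<open>act g x \<noteq> x\<close>, a small open neighbourhood \<open>P\<close> of \<open>x\<close> would be disjoint
  from \<open>act g ` P\<close>, and adding \<open>P\<close> to \<open>V\<close> would contradict maximality: \<open>P\<close> misses \<open>act g ` V\<close>, and
  \<open>act g ` P\<close> misses \<open>V\<close> because \<open>P\<close> misses \<open>act (inv g) ` V\<close>. What matters
  later is that \<open>V\<close> is displaced by \<open>g\<close> and yet three translates of it fill \<open>Q\<close> densely.\<close>

lemma maximal_displaced_open_subset:
  assumes haus: "Hausdorff_space T" and Q: "openin T Q" and g: "g \<in> carrier G" "g \<noteq> \<one>"
  obtains V where "openin T V" "V \<subseteq> Q" "V \<inter> act g ` V = {}"
    "Q \<subseteq> T closure_of (V \<union> act g ` V \<union> act (inv g) ` V)"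
proof -
  define \<S> where "\<S> = {V. openin T V \<and> V \<subseteq> Q \<and> V \<inter> act g ` V = {}}"
  have "\<exists>V\<in>\<S>. \<forall>X\<in>\<S>. V \<subseteq> X \<longrightarrow> X = V"
  proof (rule subset_Zorn')
    fix \<C> assume "subset.chain \<S> \<C>"
    then have sub: "\<C> \<subseteq> \<S>" and ch: "\<And>X Y. X \<in> \<C> \<Longrightarrow> Y \<in> \<C> \<Longrightarrow> X \<subseteq> Y \<or> Y \<subseteq> X"
      by (auto simp: subset_chain_def)
    have "X \<inter> act g ` Y = {}" if "X \<in> \<C>" "Y \<in> \<C>" for X Y
      using ch[OF that] sub that unfolding \<S>_def by blast
    then have "\<Union>\<C> \<inter> act g ` \<Union>\<C> = {}" by blast
    then show "\<Union>\<C> \<in> \<S>" using sub unfolding \<S>_def by (auto intro: openin_Union)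
  qed
  then obtain V where V: "openin T V" "V \<subseteq> Q" "V \<inter> act g ` V = {}"
    and max: "\<And>X. openin T X \<Longrightarrow> X \<subseteq> Q \<Longrightarrow> X \<inter> act g ` X = {} \<Longrightarrow> V \<subseteq> X \<Longrightarrow> X = V"
    unfolding \<S>_def mem_Collect_eq Bex_def Ball_def by (elim exE conjE, metis)
  let ?W = "V \<union> act g ` V \<union> act (inv g) ` V"
  have Vtop: "V \<subseteq> topspace T" using V openin_subset by blast
  have W: "?W \<subseteq> topspace T" using Vtop g act_closed by auto
  have "Q \<subseteq> T closure_of ?W"
  proof
    fix x assume x: "x \<in> Q"
    show "x \<in> T closure_of ?W"
    proof (rule ccontr)
      assume nx: "x \<notin> T closure_of ?W"
      have xt: "x \<in> topspace T" using x Q openin_subset by blast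
      have "act g x \<noteq> x" using act_free g xt by blast
      then obtain O1 O2 where O12: "openin T O1" "openin T O2" "x \<in> O1" "act g x \<in> O2" "O1 \<inter> O2 = {}"
        using haus xt act_closed[OF g(1) xt] unfolding Hausdorff_space_def disjnt_def by metis
      define P where "P = (Q - T closure_of ?W) \<inter> O1 \<inter> act (inv g) ` O2"
      have Pop: "openin T P"
        unfolding P_def using Q O12 g
        by (intro openin_Int openin_diff openin_act_image closedin_closure_of) auto
      have "act (inv g) (act g x) \<in> act (inv g) ` O2" using O12 by blast
      then have xP: "x \<in> P"
        unfolding P_def using x nx O12 act_inv_act[OF g(1) xt] by auto
      have "act g ` P \<subseteq> O2"
        unfolding P_def using O12(2) openin_subset[OF O12(2)] act_act_inv[OF g(1)] by auto
      then have PP: "P \<inter> act g ` P = {}" unfolding P_def using O12(5) by blast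
      have PW: "P \<inter> ?W = {}" unfolding P_def using closure_of_subset[OF W] by blast
      have VP: "V \<inter> act g ` P = {}"
      proof (rule ccontr)
        assume "V \<inter> act g ` P \<noteq> {}"
        then obtain p where p: "p \<in> P" "act g p \<in> V" by blast
        then have "act (inv g) (act g p) = p"
          using Pop act_inv_act[OF g(1)] openin_subset by blast
        then have "p \<in> act (inv g) ` V" using p(2) by (metis imageI)
        then show False using p(1) PW by blast
      qed
      have "V \<union> P = V"
      proof (rule max)
        have "P \<inter> act g ` V = {}" using PW by blast
        then show "(V \<union> P) \<inter> act g ` (V \<union> P) = {}"
          using V(3) PP VP by (simp add: image_Un Int_Un_distrib Int_Un_distrib2)
      qed (use V Pop P_def in auto)
      then show False using xP PW by blast
    qed
  qed
  then show thesis using that V by blast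
qed

text \<open>The closures of two disjoint open sets have disjoint interiors. This carries the displacement of
  the sets \<open>V n\<close> over to the interior of the intersection of their closures.\<close>

lemma closure_displaced:
  assumes g: "g \<in> carrier G" and V: "openin T V" "V \<inter> act g ` V = {}"
    and P: "openin T P" "P \<subseteq> T closure_of V"
  shows "P \<inter> act g ` P = {}"
proof (rule ccontr)
  let ?gP = "act g ` P" and ?gV = "act g ` V"
  assume ne: "P \<inter> ?gP \<noteq> {}"
  have op: "openin T ?gP" "openin T ?gV" using g P V by (auto intro: openin_act_image)
  have sub: "?gP \<subseteq> T closure_of ?gV"
    using P(2) homeomorphic_map_closure_of[OF homeomorphic_map_act[OF g] openin_subset[OF V(1)]]
    by blast
  have "P \<inter> ?gP \<inter> V \<noteq> {}"
    using ne P openin_Int_closure_of_eq_empty[of T "P \<inter> ?gP" V] op by (auto simp: openin_Int)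
  moreover have "openin T (P \<inter> ?gP \<inter> V)" using P op V by (simp add: openin_Int)
  ultimately have "P \<inter> ?gP \<inter> V \<inter> ?gV \<noteq> {}"
    using sub openin_Int_closure_of_eq_empty[of T "P \<inter> ?gP \<inter> V" ?gV] by auto
  then show False using V by blast
qed

text \<open>The construction described at the beginning. The covering set \<open>A\<close> has three parts: the boundary
  \<open>E - P\<close>, the traps \<open>D n\<close> outside \<open>E\<close>, and the set \<open>B\<close> that receives the points that end in \<open>P\<close>.\<close>

theorem meager_imp_countable_translates_cover:
  assumes haus: "Hausdorff_space T" and meager: "meager_space T" and inf: "infinite (carrier G)"
  obtains A C where "nowhere_dense_in T A" "C \<subseteq> carrier G" "countable C"
    "topspace T = (\<Union>c\<in>C. act c ` A)"
proof -
  obtain \<F> where \<F>: "countable \<F>" "\<And>A. A \<in> \<F> \<Longrightarrow> nowhere_dense_in T A" "topspace T = \<Union>\<F>"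
    using meager by (auto simp: meager_space_def)
  (* The empty set is added so that there is something to enumerate. *)
  define N where "N = from_nat_into (insert {} \<F>)"
  have rangeN: "range N = insert {} \<F>" unfolding N_def using \<F>(1) by (simp add: range_from_nat_into)
  have N: "nowhere_dense_in T (N n)" for n
    using rangeN \<F>(2) nowhere_dense_in_empty by (metis insertE rangeI)
  have N_cover: "topspace T = (\<Union>n. N n)" using rangeN \<F>(3) by simp
  obtain c :: "nat \<Rightarrow> 'a" where c: "inj c" "range c \<subseteq> carrier G"
    using inf infinite_countable_subset by blast
  have c_in: "c n \<in> carrier G" for n using c by auto

  (* Displacing P by every quotient inv (c i) \<otimes> c j is the same as making all c i P disjoint. *)
  define L where "L = {inv (c i) \<otimes> c j | i j. i \<noteq> j}"
  have "L = (\<lambda>(i, j). inv (c i) \<otimes> c j) ` {(i, j). i \<noteq> j}" unfolding L_def by auto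
  then have "countable L" by simp
  moreover have "L \<noteq> {}" unfolding L_def by (auto intro: exI[of _ 0] exI[of _ "Suc 0"])
  ultimately obtain g :: "nat \<Rightarrow> 'a" where g: "range g = L"
    by (metis range_from_nat_into)
  have "inv (c i) \<otimes> c j \<noteq> \<one>" if "i \<noteq> j" for i j
    using that c c_in by (metis inj_eq inv_closed inv_equality inv_inv)
  then have L: "l \<in> carrier G \<and> l \<noteq> \<one>" if "l \<in> L" for l
    using that c_in unfolding L_def by auto
  have g_in: "g n \<in> carrier G" and g_ne: "g n \<noteq> \<one>" for n
    using L[of "g n"] g by auto

  have step: "\<exists>V'. openin T V' \<and> V' \<subseteq> V \<and> V' \<inter> act (g n) ` V' = {} \<and>
      V \<subseteq> T closure_of (V' \<union> act (g n) ` V' \<union> act (inv (g n)) ` V')"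
    if "openin T V" for V n
    using maximal_displaced_open_subset[OF haus that g_in g_ne] by metis
  obtain V where "\<And>n. openin T (V n) \<and> (n = 0 \<longrightarrow> V n = topspace T)"
    and "\<And>n. V (Suc n) \<subseteq> V n \<and> V (Suc n) \<inter> act (g n) ` V (Suc n) = {} \<and>
      V n \<subseteq> T closure_of (V (Suc n) \<union> act (g n) ` V (Suc n) \<union> act (inv (g n)) ` V (Suc n))"
  proof (rule dependent_nat_choice[of "\<lambda>n V. openin T V \<and> (n = 0 \<longrightarrow> V = topspace T)"
      "\<lambda>n V V'. V' \<subseteq> V \<and> V' \<inter> act (g n) ` V' = {} \<and>
        V \<subseteq> T closure_of (V' \<union> act (g n) ` V' \<union> act (inv (g n)) ` V')", THEN exE])
    show "\<exists>V. openin T V \<and> (0 = (0::nat) \<longrightarrow> V = topspace T)" by blast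
    show "\<exists>V'. (openin T V' \<and> (Suc n = 0 \<longrightarrow> V' = topspace T)) \<and>
        (V' \<subseteq> V \<and> V' \<inter> act (g n) ` V' = {} \<and>
        V \<subseteq> T closure_of (V' \<union> act (g n) ` V' \<union> act (inv (g n)) ` V'))"
      if "openin T V \<and> (n = 0 \<longrightarrow> V = topspace T)" for V n
      using step[of V n] that by auto
  qed blast
  then have V_open: "\<And>n. openin T (V n)" and V_Suc: "\<And>n. V (Suc n) \<subseteq> V n"
    and V_disp: "\<And>n. V (Suc n) \<inter> act (g n) ` V (Suc n) = {}"
    and V_dense: "\<And>n. V n \<subseteq> T closure_of
          (V (Suc n) \<union> act (g n) ` V (Suc n) \<union> act (inv (g n)) ` V (Suc n))"
    and V_0: "V 0 = topspace T"
    by blast+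
  have V_top: "V n \<subseteq> topspace T" for n using V_open openin_subset by blast
  have V_dec: "decseq V" by (rule decseq_SucI) (rule V_Suc)

  define E where "E = (\<Inter>n. T closure_of V n)"
  define P where "P = T interior_of E"
  have "closedin T E" unfolding E_def by (rule closedin_Inter) auto
  then have nd_boundary: "nowhere_dense_in T (E - P)"
    unfolding P_def by (rule nowhere_dense_in_closed_minus_interior)
  have P_open: "openin T P" unfolding P_def by (rule openin_interior_of)
  have P_top: "P \<subseteq> topspace T" using P_open openin_subset by blast
  have P_disp: "P \<inter> act (g n) ` P = {}" for n
  proof (rule closure_displaced[OF g_in V_open V_disp P_open])
    show "P \<subseteq> T closure_of V (Suc n)" unfolding P_def E_def using interior_of_subset by fast
  qed
  have "act (c i) ` P \<inter> act (c j) ` P = {}" if "i \<noteq> j" for i j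
  proof -
    have "inv (c i) \<otimes> c j \<in> range g" unfolding g L_def using that by blast
    then obtain n where "g n = inv (c i) \<otimes> c j" by force
    then show ?thesis using P_disp[of n] act_image_disjoint_iff[OF c_in c_in P_top, of i j] by simp
  qed
  then have P_disj: "disjoint_family_on (\<lambda>n. act (c n) ` P) UNIV"
    by (simp add: disjoint_family_on_def)
  define B where "B = (\<Union>n. act (c n) ` (N n \<inter> P))"
  have nd_wandering: "nowhere_dense_in T B"
    unfolding B_def
  proof (rule nowhere_dense_in_disjoint_union[OF _ _ _ P_disj])
    show "nowhere_dense_in T (act (c n) ` (N n \<inter> P))" for n
      by (rule nowhere_dense_in_act_image[OF c_in nowhere_dense_in_mono[OF N]]) blast
  qed (use P_open c_in in \<open>auto intro: openin_act_image\<close>)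

  (* K n contains all group elements that can carry a point from V 0 to V n in n steps. *)
  define K where "K = rec_nat {\<one>} (\<lambda>n X. (\<lambda>(f, k). f \<otimes> k) ` ({\<one>, g n, inv (g n)} \<times> X))"
  have K_0: "K 0 = {\<one>}" and K_Suc: "K (Suc n) = (\<lambda>(f, k). f \<otimes> k) ` ({\<one>, g n, inv (g n)} \<times> K n)" for n
    by (simp_all add: K_def)
  have K_fin: "finite (K n)" for n by (induction n) (simp_all only: K_0 K_Suc, auto)
  have K_in: "K n \<subseteq> carrier G" for n
  proof (induction n)
    case (Suc n)
    then show ?case unfolding K_Suc using g_in by auto
  qed (simp add: K_0)
  define R where
    "R n = V n - (V (Suc n) \<union> act (g n) ` V (Suc n) \<union> act (inv (g n)) ` V (Suc n))" for n
  (* A point caught in D n lies in the remainder R n or has come from N n; the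
     finiteness of K n makes D n nowhere dense. *)
  define D where "D n = R n \<union> V n \<inter> (\<Union>k\<in>K n. act k ` N n)" for n
  have D_V: "D n \<subseteq> V n" for n unfolding D_def R_def by auto
  have nd_D: "nowhere_dense_in T (D n)" for n
    unfolding D_def
  proof (rule nowhere_dense_in_Un)
    show "nowhere_dense_in T (R n)"
      unfolding R_def using V_open V_dense g_in
      by (intro nowhere_dense_in_minus_dense_open openin_Un openin_act_image) auto
    have "nowhere_dense_in T (\<Union>k\<in>K n. act k ` N n)"
      using K_fin K_in N by (intro nowhere_dense_in_Union_finite) (auto intro!: nowhere_dense_in_act_image)
    then show "nowhere_dense_in T (V n \<inter> (\<Union>k\<in>K n. act k ` N n))"
      by (rule nowhere_dense_in_mono) blast
  qed
  have nd_D_E: "nowhere_dense_in T ((\<Union>n. D n) - E)"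
    unfolding E_def using nowhere_dense_in_decreasing_union[OF nd_D D_V V_top V_dec] .
  define A where "A = (E - P) \<union> ((\<Union>n. D n) - E) \<union> B"
  have nd_A: "nowhere_dense_in T A"
    unfolding A_def using nd_boundary nd_D_E nd_wandering by (intro nowhere_dense_in_Un)

  have reach_D: "\<exists>n. \<exists>k\<in>K n. act k x \<in> D n" if x: "x \<in> topspace T" for x
  proof (rule ccontr)
    assume none: "\<not> ?thesis"
    (* A point that is never caught reaches every V n; but at stage m with x in N m it is caught. *)
    have "\<exists>k\<in>K n. act k x \<in> V n" for n
    proof (induction n)
      case 0
      show ?case using x by (simp add: K_0 V_0 act_one)
    next
      case (Suc n)
      then obtain k where k: "k \<in> K n" "act k x \<in> V n" by blast
      let ?y = "act k x"
      have k_in: "k \<in> carrier G" using k K_in by blast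
      have y: "?y \<in> topspace T" using k V_top by blast
      have "?y \<notin> R n" using none k unfolding D_def by blast
      then have "?y \<in> V (Suc n) \<or> ?y \<in> act (g n) ` V (Suc n) \<or> ?y \<in> act (inv (g n)) ` V (Suc n)"
        using k unfolding R_def by blast
      then have "act \<one> ?y \<in> V (Suc n) \<or> act (inv (g n)) ?y \<in> V (Suc n) \<or> act (g n) ?y \<in> V (Suc n)"
        using act_in_image_iff[OF _ y V_top] g_in act_one[OF y] by (metis inv_closed inv_inv)
      then obtain f where f: "f \<in> {\<one>, g n, inv (g n)}" "act f ?y \<in> V (Suc n)" by blast
      then have "act (f \<otimes> k) x \<in> V (Suc n)"
        using act_mult[OF _ k_in x, of f] g_in by auto
      moreover have "f \<otimes> k \<in> K (Suc n)" unfolding K_Suc using f k by force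
      ultimately show ?case by blast
    qed
    moreover obtain m where m: "x \<in> N m" using x N_cover by blast
    ultimately obtain k where "k \<in> K m" "act k x \<in> V m" by blast
    then have "act k x \<in> D m" unfolding D_def using m by blast
    then show False using none \<open>k \<in> K m\<close> by blast
  qed
  have reach_A: "\<exists>k\<in>(\<Union>n. K n). \<exists>d\<in>insert \<one> (range c). act (d \<otimes> k) x \<in> A" if x: "x \<in> topspace T" for x
  proof -
    obtain n k where k: "k \<in> K n" "act k x \<in> D n" using reach_D[OF x] by blast
    have k_in: "k \<in> carrier G" using k K_in by blast
    show ?thesis
    proof (cases "act k x \<in> P")
      case True
      obtain m where "act k x \<in> N m" using N_cover act_closed[OF k_in x] by blast
      then have "act (c m) (act k x) \<in> A" unfolding A_def B_def using True by blast
      then have "act (c m \<otimes> k) x \<in> A" by (simp add: act_mult[OF c_in k_in x])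
      then show ?thesis using k by blast
    next
      case False
      then have "act k x \<in> A" unfolding A_def using k by blast
      then have "act (\<one> \<otimes> k) x \<in> A" using k_in by simp
      then show ?thesis using k by blast
    qed
  qed
  define C where "C = (\<lambda>(d, k). inv (d \<otimes> k)) ` (insert \<one> (range c) \<times> (\<Union>n. K n))"
  show thesis
  proof (rule that[OF nd_A])
    show C_in: "C \<subseteq> carrier G" unfolding C_def using K_in c_in by fastforce
    show "countable C"
      unfolding C_def using K_fin by (intro countable_image countable_SIGMA) (auto intro: countable_finite)
    show "topspace T = (\<Union>c\<in>C. act c ` A)"
    proof
      show "(\<Union>c\<in>C. act c ` A) \<subseteq> topspace T"
        using C_in nowhere_dense_in_subset_topspace[OF nd_A] act_closed by blast
      show "topspace T \<subseteq> (\<Union>c\<in>C. act c ` A)"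
      proof
        fix x assume x: "x \<in> topspace T"
        then obtain d k where dk: "k \<in> (\<Union>n. K n)" "d \<in> insert \<one> (range c)" "act (d \<otimes> k) x \<in> A"
          using reach_A by blast
        then have "d \<otimes> k \<in> carrier G" using K_in c_in by blast
        then have "x = act (inv (d \<otimes> k)) (act (d \<otimes> k) x)" using x by (simp add: act_inv_act)
        moreover have "inv (d \<otimes> k) \<in> C" unfolding C_def using dk by force
        ultimately show "x \<in> (\<Union>c\<in>C. act c ` A)" using dk(3) by blast
      qed
    qed
  qed
qed

end

section \<open>Translations of a paratopological group\<close>

context paratopological_group
begin

lemma continuous_left_translation:
  assumes "g \<in> carrier G" shows "continuous_map T T (\<lambda>x. g \<otimes> x)"
proof -
  have "continuous_map T (prod_topology T T) (\<lambda>x. (g, x))"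
    using assms topspace_eq_carrier by (simp add: continuous_map_pairedI)
  from continuous_map_compose[OF this continuous_mult] show ?thesis by (simp add: o_def)
qed

lemma continuous_right_translation:
  assumes "g \<in> carrier G" shows "continuous_map T T (\<lambda>x. x \<otimes> g)"
proof -
  have "continuous_map T (prod_topology T T) (\<lambda>x. (x, g))"
    using assms topspace_eq_carrier by (simp add: continuous_map_pairedI)
  from continuous_map_compose[OF this continuous_mult] show ?thesis by (simp add: o_def)
qed

lemma left_translation_action: "free_continuous_action G T (\<lambda>g x. g \<otimes> x)"
  by unfold_locales (simp_all add: continuous_left_translation topspace_eq_carrier m_assoc)

text \<open>The inverse turns right multiplication into an action from the left. For a fixed \<open>g\<close> the map is
  the right translation by \<open>inv g\<close>, hence continuous even where inversion is not.\<close>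

lemma right_translation_action: "free_continuous_action G T (\<lambda>g x. x \<otimes> inv g)"
proof unfold_locales
  fix g x assume g: "g \<in> carrier G" and x: "x \<in> topspace T" and fixed: "x \<otimes> inv g = x"
  have "inv g = \<one>" using fixed g x by (simp add: topspace_eq_carrier)
  then show "g = \<one>" using g by (metis inv_inv inv_one)
qed (simp_all add: continuous_right_translation topspace_eq_carrier m_assoc inv_mult_group)

lemma left_meager_imp_meager_space:
  assumes "left_meager G T"
  shows "meager_space T"
proof -
  interpret free_continuous_action G T "\<lambda>g x. g \<otimes> x" by (rule left_translation_action)
  obtain A C where AC: "nowhere_dense_in T A" "C \<subseteq> carrier G" "countable C" "carrier G = C <#> A"
    using assms by (auto simp: left_meager_def)
  have "topspace T = \<Union>((\<lambda>c. (\<otimes>) c ` A) ` C)"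
    using AC(4) topspace_eq_carrier by (auto simp: set_mult_def)
  then show ?thesis
    unfolding meager_space_def using AC nowhere_dense_in_act_image
    by (intro exI[of _ "(\<lambda>c. (\<otimes>) c ` A) ` C"]) auto
qed

lemma meager_space_imp_infinite_carrier: "meager_space T \<Longrightarrow> infinite (carrier G)"
  using meager_space_imp_infinite[of T] topspace_eq_carrier one_closed by auto

lemma meager_space_imp_left_meager:
  assumes "Hausdorff_space T" "meager_space T"
  shows "left_meager G T"
proof -
  interpret free_continuous_action G T "\<lambda>g x. g \<otimes> x" by (rule left_translation_action)
  obtain A C where AC: "nowhere_dense_in T A" "C \<subseteq> carrier G" "countable C"
    "topspace T = (\<Union>c\<in>C. (\<otimes>) c ` A)"
    using meager_imp_countable_translates_cover[OF assms meager_space_imp_infinite_carrier[OF assms(2)]]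
    by metis
  then have "carrier G = C <#> A" using topspace_eq_carrier by (auto simp: set_mult_def)
  then show ?thesis using AC unfolding left_meager_def by blast
qed

lemma meager_space_imp_right_meager:
  assumes "Hausdorff_space T" "meager_space T"
  shows "right_meager G T"
proof -
  interpret free_continuous_action G T "\<lambda>g x. x \<otimes> inv g" by (rule right_translation_action)
  obtain A C where AC: "nowhere_dense_in T A" "C \<subseteq> carrier G" "countable C"
    "topspace T = (\<Union>c\<in>C. (\<lambda>x. x \<otimes> inv c) ` A)"
    using meager_imp_countable_translates_cover[OF assms meager_space_imp_infinite_carrier[OF assms(2)]]
    by metis
  have "carrier G = A <#> (\<lambda>c. inv c) ` C"
    using AC(4) topspace_eq_carrier by (auto simp: set_mult_def)
  moreover have "(\<lambda>c. inv c) ` C \<subseteq> carrier G" "countable ((\<lambda>c. inv c) ` C)"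
    using AC by auto
  ultimately show ?thesis using AC(1) unfolding right_meager_def by blast
qed

end

theorem theorem1:
  fixes G :: "('a, 'b) monoid_scheme" and T :: "'a topology"
  assumes "paratopological_group G T" and "Hausdorff_space T"
  shows "meager_space T \<longleftrightarrow> shift_meager G T"
proof -
  interpret paratopological_group G T by fact
  show ?thesis
    using assms(2) left_meager_imp_meager_space meager_space_imp_left_meager
      meager_space_imp_right_meager
    unfolding shift_meager_def by blast
qed

end
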